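(* Let $\widehat{X}$ be a sandpile graph whose sink has no outgoing edges, and let $e\in\mathcal{M}(\widehat{X})$ be an idempotent with $e\neq0$. Then $G_e$ is equal to the sandpile group of $\mathcal{S}(e)$, viewed as a subgroup of $\mathcal{M}(\widehat{X})$ via the natural inclusion.
   Context: A sandpile graph $\widehat{X}$ is a finite weakly connected directed multigraph (loops and multiple edges allowed) with a distinguished vertex, the sink, reachable by a directed path from every vertex; the set $V$ of non-sink vertices is nonempty, and $X$ is the digraph obtained by deleting the sink. A configuration assigns a nonnegative integer number of grains to each non-sink vertex; it is stable if every $v$ holds fewer than $\deg^{+}(v)$ (out-degree) grains. Toppling an unstable vertex sends one grain along each of its out-edges (grains at the sink vanish; the sink never topples); every configuration has a unique stabilization. $\mathcal{M}(\widehat X)$ is the set of stable configurations with $a\oplus b$ = stabilization of $a+b$ (commutative monoid, identity $0$). The sandpile group of a sandpile graph is the minimal ideal of its sandpile monoid, a group consisting of its recurrent elements (elements accessible from every element, where $a$ is accessible from $b$ if $b\oplus x=a$ for some $x$). For an idempotent $e$, $G_e$ is the unique maximal subgroup of $\mathcal M(\widehat X)$ with identity $e$. $\operatorname{supp}(m)$ is the set of vertices holding at least one grain. A cycle is a directed closed path of length $\ge1$ in $X$. For $W\subseteq V$, $\operatorname{cl}(W)$ is the set of $z\in V$ reachable by a (possibly trivial) directed path in $X$ from some $w\in W$. A strongly connected component is a maximal subset of $V$ whose vertices mutually reach each other by paths in $X$; it is cyclic if it contains a cycle. A vertex is acyclic if it lies on no cycle. $A(e)$ is the set of acyclic $v\in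 V$ with $v\notin\operatorname{cl}(\operatorname{supp}(e))$ such that every cyclic strongly connected component reachable from $v$ in $X$ intersects $\operatorname{supp}(e)$. $\mathcal S(e)$ is the subgraph of $\widehat X$ induced on $\operatorname{cl}(\operatorname{supp}(e))\cup A(e)\cup\{\text{sink}\}$ (edges of $\widehat X$ with tail in this set), a sandpile graph with the same sink; its configurations are identified with configurations of $\widehat X$ vanishing outside its non-sink vertices (natural inclusion). *)

theory Defs
  imports "HOL-Algebra.Group" "Graph_Theory.Graph_Theory"
begin

section \<open>Sandpile graphs\<close>

locale sandpile_graph = fin_digraph G for G :: "('a, 'b) pre_digraph" (structure) +
  fixes s :: 'a
  assumes sink_in_verts: "s \<in> verts G"
    and weakly_connected: "Digraph_Component.connected G"
    and sink_reachable: "v \<in> verts G \<Longrightarrow> v \<rightarrow>\<^sup>* s"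
    and nonsink_nonempty: "verts G - {s} \<noteq> {}"

definition nonsink :: "('a, 'b) pre_digraph \<Rightarrow> 'a \<Rightarrow> 'a set" where
  "nonsink G s = verts G - {s}"

section \<open>Configurations, topplings, stabilization\<close>

text \<open>
  Configurations are total functions that vanish outside the non-sink vertices. Hence a
  configuration of a subgraph with the same sink is literally a configuration of the whole graph,
  and the natural inclusion is the identity.
\<close>

definition configs :: "('a, 'b) pre_digraph \<Rightarrow> 'a \<Rightarrow> ('a \<Rightarrow> nat) set" where
  "configs G s = {c. \<forall>v. v \<notin> nonsink G s \<longrightarrow> c v = 0}"

definition stable_configs :: "('a, 'b) pre_digraph \<Rightarrow> 'a \<Rightarrow> ('a \<Rightarrow> nat) set" where
  "stable_configs G s = {c \<in> configs G s. \<forall>v \<in> nonsink G s. c v < out_degree G v}"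

definition topple :: "('a, 'b) pre_digraph \<Rightarrow> 'a \<Rightarrow> 'a \<Rightarrow> ('a \<Rightarrow> nat) \<Rightarrow> 'a \<Rightarrow> nat" where
  "topple G s v c = (\<lambda>u. if u \<in> nonsink G s
     then c u - (if u = v then out_degree G v else 0) + card {a \<in> out_arcs G v. head G a = u}
     else 0)"

definition topple_step :: "('a, 'b) pre_digraph \<Rightarrow> 'a \<Rightarrow> ('a \<Rightarrow> nat) \<Rightarrow> ('a \<Rightarrow> nat) \<Rightarrow> bool" where
  "topple_step G s c d \<longleftrightarrow> (\<exists>v \<in> nonsink G s. out_degree G v \<le> c v \<and> d = topple G s v c)"

definition stabilize :: "('a, 'b) pre_digraph \<Rightarrow> 'a \<Rightarrow> ('a \<Rightarrow> nat) \<Rightarrow> 'a \<Rightarrow> nat" where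
  "stabilize G s c = (THE d. (topple_step G s)\<^sup>*\<^sup>* c d \<and> d \<in> stable_configs G s)"

definition sandpile_monoid :: "('a, 'b) pre_digraph \<Rightarrow> 'a \<Rightarrow> ('a \<Rightarrow> nat) monoid" where
  "sandpile_monoid G s = \<lparr>carrier = stable_configs G s,
     monoid.mult = (\<lambda>a b. stabilize G s (\<lambda>v. a v + b v)), one = (\<lambda>_. 0)\<rparr>"

section \<open>Ideals and maximal subgroups of a monoid\<close>

definition monoid_ideal :: "('m, 'n) monoid_scheme \<Rightarrow> 'm set \<Rightarrow> bool" where
  "monoid_ideal M I \<longleftrightarrow> I \<noteq> {} \<and> I \<subseteq> carrier M \<and>
     (\<forall>x \<in> carrier M. \<forall>a \<in> I. x \<otimes>\<^bsub>M\<^esub> a \<in> I \<and> a \<otimes>\<^bsub>M\<^esub> x \<in> I)"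

definition minimal_ideal :: "('m, 'n) monoid_scheme \<Rightarrow> 'm set" where
  "minimal_ideal M = (THE I. monoid_ideal M I \<and> (\<forall>J. monoid_ideal M J \<and> J \<subseteq> I \<longrightarrow> J = I))"

text \<open>
  A subgroup of a monoid in the sense of semigroup theory: its identity is an idempotent \<open>e\<close>, which
  need not be the identity of the monoid (so this is not \<^const>\<open>subgroup\<close>).
\<close>

definition subgroup_at :: "('m, 'n) monoid_scheme \<Rightarrow> 'm \<Rightarrow> 'm set \<Rightarrow> bool" where
  "subgroup_at M e H \<longleftrightarrow> H \<subseteq> carrier M \<and> group \<lparr>carrier = H, monoid.mult = monoid.mult M, one = e\<rparr>"

definition maximal_subgroup_at :: "('m, 'n) monoid_scheme \<Rightarrow> 'm \<Rightarrow> 'm set" where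
  "maximal_subgroup_at M e =
     (THE H. subgroup_at M e H \<and> (\<forall>K. subgroup_at M e K \<and> H \<subseteq> K \<longrightarrow> K = H))"

definition sandpile_group :: "('a, 'b) pre_digraph \<Rightarrow> 'a \<Rightarrow> ('a \<Rightarrow> nat) set" where
  "sandpile_group G s = minimal_ideal (sandpile_monoid G s)"

section \<open>The subgraph attached to an idempotent\<close>

definition supp :: "('a \<Rightarrow> nat) \<Rightarrow> 'a set" where
  "supp c = {v. c v \<ge> 1}"

text \<open>In the following, \<open>X\<close> is the digraph obtained by deleting the sink.\<close>

definition cl :: "('a, 'b) pre_digraph \<Rightarrow> 'a set \<Rightarrow> 'a set" where
  "cl X W = {z \<in> verts X. \<exists>w \<in> W. w \<rightarrow>\<^sup>*\<^bsub>X\<^esub> z}"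

definition acyclic_vertex :: "('a, 'b) pre_digraph \<Rightarrow> 'a \<Rightarrow> bool" where
  "acyclic_vertex X v \<longleftrightarrow>
     \<not> (\<exists>u p. pre_digraph.awalk X u p u \<and> p \<noteq> [] \<and> v \<in> set (pre_digraph.awalk_verts X u p))"

definition cyclic_scc :: "('a, 'b) pre_digraph \<Rightarrow> 'a set \<Rightarrow> bool" where
  "cyclic_scc X C \<longleftrightarrow> C \<in> pre_digraph.sccs_verts X \<and>
     (\<exists>u p. pre_digraph.awalk X u p u \<and> p \<noteq> [] \<and> set (pre_digraph.awalk_verts X u p) \<subseteq> C)"

definition A_set :: "('a, 'b) pre_digraph \<Rightarrow> ('a \<Rightarrow> nat) \<Rightarrow> 'a set" where
  "A_set X e = {v \<in> verts X. acyclic_vertex X v \<and> v \<notin> cl X (supp e) \<and>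
     (\<forall>C. cyclic_scc X C \<and> (\<exists>c \<in> C. v \<rightarrow>\<^sup>*\<^bsub>X\<^esub> c) \<longrightarrow> C \<inter> supp e \<noteq> {})}"

definition S_graph :: "('a, 'b) pre_digraph \<Rightarrow> 'a \<Rightarrow> ('a \<Rightarrow> nat) \<Rightarrow> ('a, 'b) pre_digraph" where
  "S_graph G s e = (let X = pre_digraph.del_vert G s in
     G \<restriction> (cl X (supp e) \<union> A_set X e \<union> {s}))"

lemma S_graph_simps:
  "verts (S_graph G s e) =
     cl (pre_digraph.del_vert G s) (supp e) \<union> A_set (pre_digraph.del_vert G s) e \<union> {s}"
  "tail (S_graph G s e) = tail G"
  "head (S_graph G s e) = head G"
  by (auto simp: S_graph_def Let_def)

text \<open>
  The vertex set of \<^const>\<open>S_graph\<close> is closed under out-neighbours, so the arcs of the induced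
  subgraph are exactly the arcs of the ambient graph whose tail lies in it.
\<close>

lemma S_graph_closed:
  assumes "sandpile_graph G s" "out_arcs G s = {}"
    and a: "a \<in> arcs G" "tail G a \<in> verts (S_graph G s e)"
  shows "head G a \<in> verts (S_graph G s e)"
proof (cases "head G a = s")
  case True
  then show ?thesis by (simp add: S_graph_simps)
next
  case hs: False
  interpret sandpile_graph G s by fact
  define X where "X = pre_digraph.del_vert G s"
  interpret X: wf_digraph X unfolding X_def by (rule wf_digraph_del_vert)
  have ts: "tail G a \<noteq> s" using assms(2) a(1) by auto
  have aX: "a \<in> arcs X" "tail X = tail G" "head X = head G"
    using a ts hs by (auto simp: X_def del_vert_simps)
  have adj: "tail G a \<rightarrow>\<^bsub>X\<^esub> head G a"
    using X.in_arcs_imp_in_arcs_ends[OF aX(1)] aX by simp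
  have hX: "head G a \<in> verts X" "tail G a \<in> verts X"
    using X.head_in_verts[OF aX(1)] X.tail_in_verts[OF aX(1)] aX by auto
  from a(2) ts consider "tail G a \<in> cl X (supp e)" | "tail G a \<in> A_set X e"
    by (auto simp: S_graph_simps X_def)
  then have "head G a \<in> cl X (supp e) \<union> A_set X e"
  proof cases
    case 1
    then show ?thesis using hX(1) adj X.reachable_adj_trans unfolding cl_def by blast
  next
    case 2
    have scc: "C \<inter> supp e \<noteq> {}" if "cyclic_scc X C" "c \<in> C" "head G a \<rightarrow>\<^sup>*\<^bsub>X\<^esub> c" for C c
      using 2 that X.adj_reachable_trans[OF adj that(3)] unfolding A_set_def by blast
    show ?thesis
    proof (cases "acyclic_vertex X (head G a)")
      case True
      then show ?thesis using scc hX(1) unfolding A_set_def by blast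
    next
      case False
      then obtain u p where p: "X.awalk u p u" "p \<noteq> []" "head G a \<in> set (X.awalk_verts u p)"
        by (auto simp: acyclic_vertex_def)
      let ?C = "X.scc_of (head G a)"
      have reach: "u \<rightarrow>\<^sup>*\<^bsub>X\<^esub> w" "w \<rightarrow>\<^sup>*\<^bsub>X\<^esub> u" if w: "w \<in> set (X.awalk_verts u p)" for w
      proof -
        obtain q r where "X.awalk u q w" "X.awalk w r u"
          using X.awalk_decomp[OF p(1) w] by blast
        then show "u \<rightarrow>\<^sup>*\<^bsub>X\<^esub> w" "w \<rightarrow>\<^sup>*\<^bsub>X\<^esub> u"
          by (auto intro: X.reachable_awalkI)
      qed
      have "set (X.awalk_verts u p) \<subseteq> ?C"
        using reach p(3) X.reachable_trans unfolding X.scc_of_def by blast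
      moreover have "?C \<in> X.sccs_verts"
        using hX(1) by (auto simp: X.sccs_verts_conv_scc_of)
      ultimately have cC: "cyclic_scc X ?C"
        using p unfolding cyclic_scc_def by blast
      have hC: "head G a \<in> ?C" using hX(1) by (simp add: X.scc_of_def)
      obtain w where "w \<in> ?C" "w \<in> supp e"
        using scc[OF cC hC] hX(1) by auto
      then show ?thesis using hX(1) unfolding cl_def X.scc_of_def by blast
    qed
  qed
  then show ?thesis by (simp add: S_graph_simps X_def)
qed

lemma arcs_S_graph:
  assumes "sandpile_graph G s" "out_arcs G s = {}"
  shows "arcs (S_graph G s e) = {a \<in> arcs G. tail G a \<in> verts (S_graph G s e)}"
  using S_graph_closed[OF assms] by (auto simp: S_graph_def Let_def)

lemma sandpile_graph_S_graph:
  assumes "sandpile_graph G s" "out_arcs G s = {}"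
    and "e \<in> carrier (sandpile_monoid G s)" "e \<noteq> \<one>\<^bsub>sandpile_monoid G s\<^esub>"
  shows "sandpile_graph (S_graph G s e) s"
proof -
  interpret sandpile_graph G s by fact
  let ?S = "S_graph G s e"
  have sub: "verts ?S \<subseteq> verts G"
    using sink_in_verts by (auto simp: S_graph_simps cl_def A_set_def del_vert_simps)
  interpret S: fin_digraph ?S
    using finite_subset[OF sub] S_graph_closed[OF assms(1,2)] arcs_S_graph[OF assms(1,2)]
    by unfold_locales (auto simp: S_graph_simps(2,3))
  have reach: "v \<rightarrow>\<^sup>*\<^bsub>?S\<^esub> s" if "v \<in> verts ?S" for v
  proof -
    have "v \<rightarrow>\<^sup>*\<^bsub>G\<^esub> s" using that sub sink_reachable by blast
    then show ?thesis using that
    proof (induction rule: converse_reachable_induct)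
      case base
      then show ?case by simp
    next
      case (step x y)
      then obtain a where a: "a \<in> arcs G" "tail G a = x" "head G a = y" by auto
      then have y: "y \<in> verts ?S" using S_graph_closed[OF assms(1,2), of a e] step.prems by simp
      have "a \<in> arcs ?S" using a step.prems arcs_S_graph[OF assms(1,2), of e] by simp
      then have "x \<rightarrow>\<^bsub>?S\<^esub> y"
        using S.in_arcs_imp_in_arcs_ends[of a] a by (simp add: S_graph_simps)
      then show ?case using step.IH[OF y] by (rule S.adj_reachable_trans)
    qed
  qed
  obtain v where v: "e v \<noteq> 0" using assms(4) by (auto simp: sandpile_monoid_def)
  then have "v \<in> verts G - {s}"
    using assms(3) by (auto simp: sandpile_monoid_def stable_configs_def configs_def nonsink_def)
  then have vV: "v \<in> verts (pre_digraph.del_vert G s)" by (simp add: verts_del_vert)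
  interpret X: wf_digraph "pre_digraph.del_vert G s" by (rule wf_digraph_del_vert)
  have "v \<in> cl (pre_digraph.del_vert G s) (supp e)"
    using v vV by (auto simp: cl_def supp_def intro!: exI[of _ v])
  moreover have "v \<noteq> s" using vV by (simp add: verts_del_vert)
  ultimately have ne: "verts ?S - {s} \<noteq> {}" by (auto simp: S_graph_simps)
  interpret P: pair_wf_digraph "mk_symmetric ?S" by (rule S.wellformed_mk_symmetric)
  have sym: "u \<rightarrow>\<^sup>*\<^bsub>mk_symmetric ?S\<^esub> w" if "u \<in> verts ?S" "w \<in> verts ?S" for u w
    using S.reachable_mk_symmetricI[OF reach[OF that(1)]]
      symmetric_reachable[OF symmetric_mk_symmetric S.reachable_mk_symmetricI[OF reach[OF that(2)]]]
    by (rule P.reachable_trans)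
  have "Digraph_Component.connected ?S"
    using sym by (auto simp: Digraph_Component.connected_def strongly_connected_def S_graph_simps)
  then show ?thesis
    using reach ne by unfold_locales (auto simp: S_graph_simps)
qed

end

theory Submission
  imports Defs
begin

text \<open>
  Call a configuration \<open>c\<close> good if some \<open>y\<close> satisfies \<open>stabilize (c + y) = e\<close>. As \<open>e\<close> is idempotent,
  good configurations are closed under sums, so \<open>c\<close> is good iff a single grain on each vertex of its
  support is. Toppling shows that a grain on \<open>v\<close> is good iff grains on all non-sink out-neighbours
  of \<open>v\<close> are. A cycle that holds a grain holds one forever, so a cycle with a good vertex
  meets the support of \<open>e\<close>. These facts identify the good vertices with
  \<open>cl (supp e) \<union> A(e)\<close>. Thus every member of the group at \<open>e\<close> is a configuration of \<open>\<S>(e)\<close>, and \<open>e\<close>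
  is accessible from every element of the monoid of \<open>\<S>(e)\<close>, which makes \<open>e\<close> the identity of the minimal ideal.
\<close>

section \<open>Stabilization\<close>

text \<open>The grains that \<open>u\<close> receives when \<open>v\<close> topples, with
  multiplicity. Grains falling into the sink are set to 0 so that \<open>flow G s v\<close> is
  itself a configuration.\<close>

definition flow :: "('a, 'b) pre_digraph \<Rightarrow> 'a \<Rightarrow> 'a \<Rightarrow> 'a \<Rightarrow> nat" where
  "flow G s v u = (if u \<in> nonsink G s then card {a \<in> out_arcs G v. head G a = u} else 0)"

context sandpile_graph
begin

section \<open>Weights that measure progress towards the sink\<close>

lemma finite_nonsink: "finite (nonsink G s)"
  by (simp add: nonsink_def)

text \<open>\<open>d\<close> is the directed distance to the sink, and the arc wanted is the first
  one of a shortest path.\<close>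

lemma nonsink_has_arc_towards_sink:
  obtains d :: "'a \<Rightarrow> nat" where "d s = 0"
    "\<And>v. v \<in> nonsink G s \<Longrightarrow> \<exists>a \<in> out_arcs G v. d (head G a) < d v"
proof -
  define d where "d v = (LEAST n. (v, s) \<in> arcs_ends G ^^ n)" for v
  have d0: "d s = 0" unfolding d_def by (rule Least_eq_0) simp
  have "\<exists>a \<in> out_arcs G v. d (head G a) < d v" if v: "v \<in> nonsink G s" for v
  proof -
    have "(v, s) \<in> (arcs_ends G)\<^sup>*"
      using v reachable_rtranclI[OF sink_reachable] by (simp add: nonsink_def)
    then have "\<exists>n. (v, s) \<in> arcs_ends G ^^ n" by (simp add: rtrancl_power)
    then have dv: "(v, s) \<in> arcs_ends G ^^ d v" unfolding d_def by (rule LeastI_ex)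
    have "d v \<noteq> 0"
    proof
      assume "d v = 0"
      then show False using dv v by (simp add: nonsink_def)
    qed
    then obtain n where n: "d v = Suc n" using not0_implies_Suc by blast
    then obtain u where u: "(v, u) \<in> arcs_ends G" "(u, s) \<in> arcs_ends G ^^ n"
      using dv relpow_Suc_D2 by metis
    have "d u \<le> n" unfolding d_def by (rule Least_le) (rule u(2))
    with u(1) n show ?thesis by force
  qed
  with d0 show thesis by (rule that)
qed

lemma out_degree_pos:
  assumes "v \<in> nonsink G s" shows "0 < out_degree G v"
proof -
  obtain d :: "'a \<Rightarrow> nat" where "\<exists>a \<in> out_arcs G v. d (head G a) < d v"
    using nonsink_has_arc_towards_sink assms by blast
  then show ?thesis by (auto simp: out_degree_def card_gt_0_iff)
qed

text \<open>
  With \<open>d\<close> decreasing along some arc of every non-sink vertex, the weight \<open>B ^ D - B ^ (D - d v)\<close>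
  is strictly superharmonic as soon as \<open>B\<close> exceeds all out-degrees.
\<close>

lemma superharmonic_weight:
  obtains w :: "'a \<Rightarrow> nat" where "w s = 0"
    "\<And>v. v \<in> nonsink G s \<Longrightarrow> (\<Sum>a \<in> out_arcs G v. w (head G a)) < out_degree G v * w v"
proof -
  obtain d :: "'a \<Rightarrow> nat" where ds: "d s = 0"
    and d: "\<And>v. v \<in> nonsink G s \<Longrightarrow> \<exists>a \<in> out_arcs G v. d (head G a) < d v"
    using nonsink_has_arc_towards_sink by blast
  define D where "D = (\<Sum>v \<in> verts G. d v)"
  define B where "B = Suc (card (arcs G))"
  have dD: "d v \<le> D" if "v \<in> verts G" for v
    unfolding D_def using that by (intro member_le_sum) auto
  define w where "w v = B ^ D - B ^ (D - d v)" for v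
  \<comment> \<open>Over the integers the difference defining \<open>w\<close> is linear, so it can
    be summed over out-arcs without truncation.\<close>
  have wi: "int (w v) = int (B ^ D) - int (B ^ (D - d v))" for v
    unfolding w_def by (rule of_nat_diff) (simp add: B_def power_increasing del: power_Suc)
  show thesis
  proof
    show "w s = 0" by (simp add: w_def ds)
    fix v assume v: "v \<in> nonsink G s"
    obtain a where a: "a \<in> out_arcs G v" "d (head G a) < d v" using d[OF v] by blast
    have vG: "v \<in> verts G" using v by (simp add: nonsink_def)
    have "out_degree G v < B"
      unfolding B_def out_degree_def less_Suc_eq_le by (rule card_mono) auto
    then have "out_degree G v * B ^ (D - d v) < B * B ^ (D - d v)"
      by (intro mult_strict_right_mono) (simp_all add: B_def)
    also have "\<dots> = B ^ Suc (D - d v)" by simp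
    \<comment> \<open>The head of \<open>a\<close> is closer to the sink and
      \<open>d v \<le> D\<close>, so the exponent grows by at least one. This single arc outweighs
      all \<open>out_degree G v\<close> copies of \<open>B ^ (D - d v)\<close>.\<close>
    also have "\<dots> \<le> B ^ (D - d (head G a))"
      using a(2) dD[OF vG] by (intro power_increasing) (auto simp: B_def)
    also have "\<dots> \<le> (\<Sum>b \<in> out_arcs G v. B ^ (D - d (head G b)))"
      using a(1) by (intro member_le_sum) auto
    finally have "int (out_degree G v * B ^ (D - d v))
        < int (\<Sum>b \<in> out_arcs G v. B ^ (D - d (head G b)))"
      by (simp only: of_nat_less_iff)
    moreover have "int (\<Sum>b \<in> out_arcs G v. w (head G b))
        = int (out_degree G v) * int (B ^ D) - int (\<Sum>b \<in> out_arcs G v. B ^ (D - d (head G b)))"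
      by (simp only: of_nat_sum wi sum_subtractf sum_constant out_degree_def)
    moreover have "int (out_degree G v * w v)
        = int (out_degree G v) * int (B ^ D) - int (out_degree G v * B ^ (D - d v))"
      by (simp only: of_nat_mult wi right_diff_distrib)
    ultimately have "int (\<Sum>b \<in> out_arcs G v. w (head G b)) < int (out_degree G v * w v)"
      by linarith
    then show "(\<Sum>b \<in> out_arcs G v. w (head G b)) < out_degree G v * w v"
      by (simp only: of_nat_less_iff)
  qed
qed

text \<open>Out-arcs are grouped by their heads; since the sink has weight 0, grains lost there do
  not disturb the sum.\<close>

lemma sum_flow:
  assumes "w s = 0"
  shows "(\<Sum>u \<in> nonsink G s. flow G s v u * w u) = (\<Sum>a \<in> out_arcs G v. w (head G a))"
proof -
  have "(\<Sum>a \<in> out_arcs G v. w (head G a))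
      = (\<Sum>u \<in> verts G. \<Sum>a \<in> {a \<in> out_arcs G v. head G a = u}. w (head G a))"
    by (rule sum.group[symmetric]) auto
  also have "\<dots> = (\<Sum>u \<in> verts G. card {a \<in> out_arcs G v. head G a = u} * w u)"
    by (intro sum.cong) auto
  also have "\<dots> = (\<Sum>u \<in> nonsink G s. card {a \<in> out_arcs G v. head G a = u} * w u)"
    using assms by (intro sum.mono_neutral_right) (auto simp: nonsink_def)
  also have "\<dots> = (\<Sum>u \<in> nonsink G s. flow G s v u * w u)"
    by (intro sum.cong) (auto simp: flow_def)
  finally show ?thesis by simp
qed

section \<open>Topplings as additive moves\<close>

lemma flow_in_configs: "flow G s v \<in> configs G s"
  by (simp add: configs_def flow_def)

text \<open>Splitting off the \<open>out_degree G v\<close> grains that leave \<open>v\<close>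
  removes the truncated subtraction: a toppling exchanges these grains for \<open>flow G s v\<close>
  and leaves the remainder \<open>y\<close> alone.\<close>

lemma topple_add:
  assumes "y \<in> configs G s" "v \<in> nonsink G s"
  shows "topple G s v (\<lambda>u. (if u = v then out_degree G v else 0) + y u) = (\<lambda>u. flow G s v u + y u)"
  using assms by (auto simp: topple_def flow_def configs_def)

lemma topple_stepE:
  assumes "topple_step G s c d" "c \<in> configs G s"
  obtains v y where "v \<in> nonsink G s" "y \<in> configs G s"
    "c = (\<lambda>u. (if u = v then out_degree G v else 0) + y u)" "d = (\<lambda>u. flow G s v u + y u)"
proof -
  obtain v where v: "v \<in> nonsink G s" "out_degree G v \<le> c v" "d = topple G s v c"
    using assms(1) by (auto simp: topple_step_def)
  define y where "y u = c u - (if u = v then out_degree G v else 0)" for u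
  have "y \<in> configs G s" using assms(2) by (simp add: y_def configs_def)
  moreover have "c = (\<lambda>u. (if u = v then out_degree G v else 0) + y u)"
    using v(2) by (auto simp: y_def)
  ultimately show thesis using that[OF v(1)] v(3) topple_add[OF _ v(1)] by blast
qed

lemma topple_stepI:
  assumes "v \<in> nonsink G s" "y \<in> configs G s"
  shows "topple_step G s (\<lambda>u. (if u = v then out_degree G v else 0) + y u) (\<lambda>u. flow G s v u + y u)"
  using assms topple_add[OF assms(2,1)] unfolding topple_step_def by (intro bexI[of _ v]) auto

lemma configs_add: "a \<in> configs G s \<Longrightarrow> b \<in> configs G s \<Longrightarrow> (\<lambda>v. a v + b v) \<in> configs G s"
  by (simp add: configs_def)

lemma topple_step_configs: "topple_step G s c d \<Longrightarrow> d \<in> configs G s"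
  by (auto simp: topple_step_def topple_def configs_def)

lemma topple_steps_configs: "(topple_step G s)\<^sup>*\<^sup>* c d \<Longrightarrow> c \<in> configs G s \<Longrightarrow> d \<in> configs G s"
  by (induction rule: rtranclp_induct) (auto intro: topple_step_configs)

text \<open>Extra grains join the untouched remainder, so a legal toppling stays legal.\<close>

lemma topple_step_add:
  assumes "topple_step G s c d" "c \<in> configs G s" "b \<in> configs G s"
  shows "topple_step G s (\<lambda>u. c u + b u) (\<lambda>u. d u + b u)"
proof -
  obtain v y where vy: "v \<in> nonsink G s" "y \<in> configs G s"
    "c = (\<lambda>u. (if u = v then out_degree G v else 0) + y u)" "d = (\<lambda>u. flow G s v u + y u)"
    by (rule topple_stepE[OF assms(1,2)])
  show ?thesis
    using topple_stepI[OF vy(1) configs_add[OF vy(2) assms(3)]] by (simp add: vy(3,4) add.assoc)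
qed

lemma topple_steps_add:
  assumes "(topple_step G s)\<^sup>*\<^sup>* c d" "c \<in> configs G s" "b \<in> configs G s"
  shows "(topple_step G s)\<^sup>*\<^sup>* (\<lambda>u. c u + b u) (\<lambda>u. d u + b u)"
  using assms(1)
proof (induction rule: rtranclp_induct)
  case base
  then show ?case by simp
next
  case (step d d')
  then show ?case
    using topple_step_add topple_steps_configs assms(2,3) by (meson rtranclp.rtrancl_into_rtrancl)
qed

section \<open>Confluence, termination and unique stabilization\<close>

text \<open>Toppling one vertex takes no grain from another, so two distinct legal topplings can be
  performed in either order with the same result.\<close>

lemma topple_step_diamond:
  assumes "topple_step G s c c1" "topple_step G s c c2" "c \<in> configs G s" "c1 \<noteq> c2"
  shows "\<exists>d. topple_step G s c1 d \<and> topple_step G s c2 d"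
proof -
  obtain v y where v: "v \<in> nonsink G s" "y \<in> configs G s"
    "c = (\<lambda>u. (if u = v then out_degree G v else 0) + y u)" "c1 = (\<lambda>u. flow G s v u + y u)"
    by (rule topple_stepE[OF assms(1,3)])
  obtain w z where w: "w \<in> nonsink G s" "z \<in> configs G s"
    "c = (\<lambda>u. (if u = w then out_degree G w else 0) + z u)" "c2 = (\<lambda>u. flow G s w u + z u)"
    by (rule topple_stepE[OF assms(2,3)])
  have eq: "(if u = v then out_degree G v else 0) + y u = (if u = w then out_degree G w else 0) + z u"
    for u using v(3) w(3) by metis
  have "v \<noteq> w"
  proof
    assume "v = w"
    then have "y = z" using eq by auto
    with \<open>v = w\<close> v(4) w(4) assms(4) show False by simp
  qed
  \<comment> \<open>What remains of \<open>c\<close> once both \<open>v\<close> and \<open>w\<close>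
    have given up their out-degrees.\<close>
  define x where "x u = (if u = w then y u - out_degree G w else y u)" for u
  have y: "y = (\<lambda>u. (if u = w then out_degree G w else 0) + x u)"
    using eq[of w] \<open>v \<noteq> w\<close> by (auto simp: x_def)
  have z: "z = (\<lambda>u. (if u = v then out_degree G v else 0) + x u)"
  proof
    fix u show "z u = (if u = v then out_degree G v else 0) + x u"
      using eq[of u] fun_cong[OF y, of u] by simp
  qed
  have x: "x \<in> configs G s" using v(2) by (simp add: x_def configs_def)
  have "topple_step G s c1 (\<lambda>u. flow G s v u + (flow G s w u + x u))"
    using topple_stepI[OF w(1) configs_add[OF flow_in_configs[of v] x]]
    by (simp add: v(4) y add.left_commute)
  moreover have "topple_step G s c2 (\<lambda>u. flow G s v u + (flow G s w u + x u))"
    using topple_stepI[OF v(1) configs_add[OF flow_in_configs[of w] x]]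
    by (simp add: w(4) z add.left_commute)
  ultimately show ?thesis by blast
qed

text \<open>Termination: \<open>\<Phi>\<close> is the total weight of the grains for a superharmonic
  weight, so grains leaving \<open>v\<close> are worth strictly more than those that arrive.\<close>

lemma topple_step_decreases:
  obtains \<Phi> :: "('a \<Rightarrow> nat) \<Rightarrow> nat" where
    "\<And>c d. topple_step G s c d \<Longrightarrow> c \<in> configs G s \<Longrightarrow> \<Phi> d < \<Phi> c"
proof -
  obtain w :: "'a \<Rightarrow> nat" where w: "w s = 0"
    "\<And>v. v \<in> nonsink G s \<Longrightarrow> (\<Sum>a \<in> out_arcs G v. w (head G a)) < out_degree G v * w v"
    using superharmonic_weight by blast
  define \<Phi> where "\<Phi> c = (\<Sum>u \<in> nonsink G s. c u * w u)" for c :: "'a \<Rightarrow> nat"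
  show thesis
  proof
    fix c d assume "topple_step G s c d" "c \<in> configs G s"
    from this obtain v y where v: "v \<in> nonsink G s" "y \<in> configs G s"
      "c = (\<lambda>u. (if u = v then out_degree G v else 0) + y u)" "d = (\<lambda>u. flow G s v u + y u)"
      by (rule topple_stepE)
    have "(\<Sum>u \<in> nonsink G s. (if u = v then out_degree G v else 0) * w u) = out_degree G v * w v"
      using v(1) finite_nonsink by (simp add: if_distrib[of "\<lambda>x. x * _"] cong: if_cong)
    then show "\<Phi> d < \<Phi> c"
      using w(2)[OF v(1)] sum_flow[of w v, OF w(1)]
      by (simp add: \<Phi>_def v(3,4) add_mult_distrib sum.distrib)
  qed
qed

lemma stable_no_step: "c \<in> stable_configs G s \<Longrightarrow> \<not> topple_step G s c d"
  by (auto simp: stable_configs_def topple_step_def)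

lemma unstable_step: "c \<in> configs G s \<Longrightarrow> c \<notin> stable_configs G s \<Longrightarrow> \<exists>d. topple_step G s c d"
  by (auto simp: stable_configs_def topple_step_def not_less)

lemma stable_in_configs: "c \<in> stable_configs G s \<Longrightarrow> c \<in> configs G s"
  by (simp add: stable_configs_def)

text \<open>The argument of Newman's lemma: induction on \<open>\<Phi>\<close>, with the diamond
  property joining two different first topplings.\<close>

lemma unique_stabilization:
  assumes "c \<in> configs G s"
  shows "\<exists>!d. (topple_step G s)\<^sup>*\<^sup>* c d \<and> d \<in> stable_configs G s"
proof -
  obtain \<Phi> :: "('a \<Rightarrow> nat) \<Rightarrow> nat" where
    \<Phi>: "\<And>c d. topple_step G s c d \<Longrightarrow> c \<in> configs G s \<Longrightarrow> \<Phi> d < \<Phi> c"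
    using topple_step_decreases by blast
  show ?thesis using assms
  proof (induction c rule: measure_induct_rule[of \<Phi>])
    case (less c)
    let ?N = "\<lambda>c d. (topple_step G s)\<^sup>*\<^sup>* c d \<and> d \<in> stable_configs G s"
    have IH: "\<exists>!d. ?N c' d" if "topple_step G s c c'" for c'
      using less.IH \<Phi> less.prems that topple_step_configs by blast
    show ?case
    proof (cases "c \<in> stable_configs G s")
      case True
      then show ?thesis using stable_no_step by (metis converse_rtranclpE rtranclp.rtrancl_refl)
    next
      case False
      obtain c1 d1 where c1: "topple_step G s c c1" "?N c1 d1"
        using unstable_step[OF less.prems False] IH by blast
      show ?thesis
      proof (rule ex1I[of _ d1])
        show "?N c d1" using c1 by (meson converse_rtranclp_into_rtranclp)
        fix d2 assume d2: "?N c d2"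
        then obtain c2 where c2: "topple_step G s c c2" "?N c2 d2"
          using False by (metis converse_rtranclpE)
        show "d2 = d1"
        proof (cases "c1 = c2")
          case True
          then show ?thesis using IH[OF c1(1)] c1 c2 by blast
        next
          case ne: False
          obtain c' where c': "topple_step G s c1 c'" "topple_step G s c2 c'"
            using topple_step_diamond[OF c1(1) c2(1) less.prems ne] by blast
          have "\<Phi> c' < \<Phi> c"
            using \<Phi>[OF c1(1) less.prems] \<Phi>[OF c'(1) topple_step_configs[OF c1(1)]] by simp
          \<comment> \<open>A stabilization of the common successor stabilizes both
            \<open>c1\<close> and \<open>c2\<close>, so the uniqueness already known for each of
            them forces \<open>d1 = d' = d2\<close>.\<close>
          then obtain d' where d': "?N c' d'"
            using less.IH topple_step_configs[OF c'(1)] by blast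
          then have "?N c1 d'" "?N c2 d'"
            using c' by (auto intro: converse_rtranclp_into_rtranclp)
          then show ?thesis using IH[OF c1(1)] IH[OF c2(1)] c1 c2 by blast
        qed
      qed
    qed
  qed
qed

section \<open>Stabilization of sums and the monoid laws\<close>

lemma stabilize_steps:
  assumes "c \<in> configs G s"
  shows "(topple_step G s)\<^sup>*\<^sup>* c (stabilize G s c)" "stabilize G s c \<in> stable_configs G s"
  using theI'[OF unique_stabilization[OF assms]] unfolding stabilize_def by auto

lemma stabilize_eqI:
  assumes "c \<in> configs G s" "(topple_step G s)\<^sup>*\<^sup>* c d" "d \<in> stable_configs G s"
  shows "stabilize G s c = d"
  using unique_stabilization[OF assms(1)] stabilize_steps[OF assms(1)] assms(2,3) by blast

lemma stabilize_cong_steps: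
  assumes "c \<in> configs G s" "(topple_step G s)\<^sup>*\<^sup>* c d"
  shows "stabilize G s c = stabilize G s d"
  using assms stabilize_steps[OF topple_steps_configs[OF assms(2,1)]]
  by (intro stabilize_eqI) auto

lemma stabilize_stable: "c \<in> stable_configs G s \<Longrightarrow> stabilize G s c = c"
  by (rule stabilize_eqI) (auto intro: stable_in_configs)

text \<open>The topplings that stabilize \<open>a\<close> remain legal in the presence of
  \<open>b\<close>, so a summand may be stabilized beforehand.\<close>

lemma stabilize_stabilize_add:
  assumes "a \<in> configs G s" "b \<in> configs G s"
  shows "stabilize G s (\<lambda>v. stabilize G s a v + b v) = stabilize G s (\<lambda>v. a v + b v)"
  using stabilize_cong_steps[OF configs_add[OF assms]
      topple_steps_add[OF stabilize_steps(1)[OF assms(1)] assms]] by simp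

text \<open>Both bracketings are the stabilization of the plain sum \<open>x + y + z\<close>. The
  zero configuration is stable because out-degrees are positive.\<close>

lemma comm_monoid_sandpile_monoid: "comm_monoid (sandpile_monoid G s)"
proof (rule comm_monoidI)
  fix x y z
  assume x: "x \<in> carrier (sandpile_monoid G s)" and y: "y \<in> carrier (sandpile_monoid G s)"
    and z: "z \<in> carrier (sandpile_monoid G s)"
  then have xyz: "x \<in> configs G s" "y \<in> configs G s" "z \<in> configs G s"
    by (auto simp: sandpile_monoid_def stable_in_configs)
  show "x \<otimes>\<^bsub>sandpile_monoid G s\<^esub> y \<otimes>\<^bsub>sandpile_monoid G s\<^esub> z
      = x \<otimes>\<^bsub>sandpile_monoid G s\<^esub> (y \<otimes>\<^bsub>sandpile_monoid G s\<^esub> z)"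
    using stabilize_stabilize_add[OF configs_add[OF xyz(1,2)] xyz(3)]
      stabilize_stabilize_add[OF configs_add[OF xyz(2,3)] xyz(1)]
    by (simp add: sandpile_monoid_def ac_simps)
next
  show "\<one>\<^bsub>sandpile_monoid G s\<^esub> \<in> carrier (sandpile_monoid G s)"
    using out_degree_pos by (simp add: sandpile_monoid_def stable_configs_def configs_def)
next
  fix x y
  assume "x \<in> carrier (sandpile_monoid G s)" "y \<in> carrier (sandpile_monoid G s)"
  then show "x \<otimes>\<^bsub>sandpile_monoid G s\<^esub> y \<in> carrier (sandpile_monoid G s)"
    using stabilize_steps(2)[OF configs_add[OF stable_in_configs stable_in_configs]]
    by (simp add: sandpile_monoid_def)
qed (auto simp: sandpile_monoid_def stabilize_stable add.commute)

end

section \<open>Good configurations\<close>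

text \<open>
  Abstracts cycles of the sink-free graph: all that matters is that a vertex of \<open>Z\<close> that topples
  passes a grain to \<open>Z\<close>.
\<close>

lemma (in sandpile_graph) topple_steps_keep_grain:
  assumes "(topple_step G s)\<^sup>*\<^sup>* c d" "c \<in> configs G s" "Z \<subseteq> nonsink G s"
    and Z: "\<And>z. z \<in> Z \<Longrightarrow> \<exists>a \<in> out_arcs G z. head G a \<in> Z"
    and "\<exists>z \<in> Z. c z \<noteq> 0"
  shows "\<exists>z \<in> Z. d z \<noteq> 0"
  using assms(1)
proof (induction rule: rtranclp_induct)
  case base
  then show ?case using assms(5) .
next
  case (step d d')
  have "d \<in> configs G s" using topple_steps_configs step.hyps(1) assms(2) by blast
  with step.hyps(2) obtain v y where v: "v \<in> nonsink G s" "y \<in> configs G s"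
    "d = (\<lambda>u. (if u = v then out_degree G v else 0) + y u)" "d' = (\<lambda>u. flow G s v u + y u)"
    by (rule topple_stepE)
  show ?case
  proof (cases "v \<in> Z")
    case True
    then obtain a where a: "a \<in> out_arcs G v" "head G a \<in> Z" using Z by blast
    moreover have "finite {b \<in> out_arcs G v. head G b = head G a}"
      by (rule finite_subset[of _ "arcs G"]) auto
    ultimately have "flow G s v (head G a) \<noteq> 0"
      using assms(3) by (auto simp: flow_def card_gt_0_iff simp del: in_out_arcs_conv)
    then show ?thesis using a(2) v(4) by auto
  next
    case False
    \<comment> \<open>A toppling outside \<open>Z\<close> takes no grain from
      \<open>Z\<close>.\<close>
    obtain z where "z \<in> Z" "d z \<noteq> 0" using step.IH by blast
    moreover have "z \<noteq> v" using \<open>z \<in> Z\<close> False by blast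
    ultimately have "d' z \<noteq> 0" using fun_cong[OF v(3), of z] fun_cong[OF v(4), of z] by simp
    then show ?thesis using \<open>z \<in> Z\<close> by blast
  qed
qed

locale sandpile_idempotent = sandpile_graph +
  fixes e :: "'a \<Rightarrow> nat"
  assumes e_stable: "e \<in> stable_configs G s"
    and e_idem: "stabilize G s (\<lambda>v. e v + e v) = e"
begin

text \<open>Accessibility of \<open>e\<close> from \<open>c\<close>, extended to arbitrary
  configurations: neither \<open>c\<close> nor \<open>y\<close> has to be stable, so the notion can
  be followed through sums and topplings.\<close>

definition good :: "('a \<Rightarrow> nat) \<Rightarrow> bool" where
  "good c \<longleftrightarrow> c \<in> configs G s \<and> (\<exists>y \<in> configs G s. stabilize G s (\<lambda>v. c v + y v) = e)"

definition grain :: "'a \<Rightarrow> 'a \<Rightarrow> nat" where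
  "grain v u = (if u = v then 1 else 0)"

abbreviation "sinkless \<equiv> pre_digraph.del_vert G s"

section \<open>Closure properties of good configurations\<close>

lemma e_config: "e \<in> configs G s"
  using e_stable by (rule stable_in_configs)

text \<open>The witnesses are added; the total stabilizes to that of \<open>e + e\<close>, which is
  \<open>e\<close> by idempotence.\<close>

lemma good_add:
  assumes "good c" "good d" shows "good (\<lambda>v. c v + d v)"
proof -
  obtain x y where x: "c \<in> configs G s" "x \<in> configs G s" "stabilize G s (\<lambda>v. c v + x v) = e"
    and y: "d \<in> configs G s" "y \<in> configs G s" "stabilize G s (\<lambda>v. d v + y v) = e"
    using assms unfolding good_def by blast
  have "stabilize G s (\<lambda>v. (c v + x v) + (d v + y v)) = stabilize G s (\<lambda>v. e v + (d v + y v))"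
    using stabilize_stabilize_add[OF configs_add[OF x(1,2)] configs_add[OF y(1,2)]] x(3) by simp
  also have "\<dots> = stabilize G s (\<lambda>v. e v + e v)"
    using stabilize_stabilize_add[OF configs_add[OF y(1,2)] e_config] y(3) by (simp add: add.commute)
  finally have "stabilize G s (\<lambda>v. (c v + d v) + (x v + y v)) = e"
    by (simp add: e_idem ac_simps)
  then show ?thesis
    unfolding good_def using configs_add[OF x(1) y(1)] configs_add[OF x(2) y(2)]
    by (intro conjI bexI[of _ "\<lambda>v. x v + y v"])
qed

text \<open>The surplus \<open>d - c\<close> is moved into the witness.\<close>

lemma good_mono:
  assumes "good d" "\<And>v. c v \<le> d v" shows "good c"
proof -
  obtain y where y: "d \<in> configs G s" "y \<in> configs G s" "stabilize G s (\<lambda>v. d v + y v) = e"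
    using assms(1) unfolding good_def by blast
  have "(\<lambda>v. d v - c v + y v) \<in> configs G s" using y by (simp add: configs_def)
  moreover have eq: "(\<lambda>v. c v + (d v - c v + y v)) = (\<lambda>v. d v + y v)"
  proof
    fix v show "c v + (d v - c v + y v) = d v + y v" using assms(2)[of v] by simp
  qed
  moreover have "c \<in> configs G s"
    unfolding configs_def
  proof (intro CollectI allI impI)
    fix v assume "v \<notin> nonsink G s"
    then have "d v = 0" using y(1) by (simp add: configs_def)
    then show "c v = 0" using assms(2)[of v] by simp
  qed
  ultimately show ?thesis unfolding good_def using y(3)
    by (intro conjI bexI[of _ "\<lambda>v. d v - c v + y v"]) (simp_all only: eq)
qed

lemma good_zero: "good (\<lambda>_. 0)"
  unfolding good_def using e_config stabilize_stable[OF e_stable]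
  by (intro conjI bexI[of _ e]) (auto simp: configs_def)

text \<open>Goodness passes to smaller configurations and to sums. Hence the number of grains on a
  vertex is irrelevant, and goodness becomes a property of vertices.\<close>

lemma good_iff_grains:
  assumes "c \<in> configs G s"
  shows "good c \<longleftrightarrow> (\<forall>v \<in> supp c. good (grain v))"
proof
  assume "good c"
  then show "\<forall>v \<in> supp c. good (grain v)"
    by (auto simp: supp_def grain_def intro: good_mono)
next
  assume "\<forall>v \<in> supp c. good (grain v)"
  then show "good c" using assms
  proof (induction c rule: measure_induct_rule[of "\<lambda>c. sum c (nonsink G s)"])
    case (less c)
    show ?case
    proof (cases "supp c = {}")
      case True
      then have "c = (\<lambda>_. 0)" by (auto simp: supp_def not_less_eq_eq fun_eq_iff)
      then show ?thesis using good_zero by simp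
    next
      case False
      then obtain v where v: "v \<in> supp c" by blast
      \<comment> \<open>One grain is peeled off at \<open>v\<close>, which lowers the total number
        of grains.\<close>
      define d where "d u = c u - grain v u" for u
      have c: "c = (\<lambda>u. grain v u + d u)" using v by (auto simp: d_def grain_def supp_def)
      have "v \<in> nonsink G s" using v less.prems(2) by (auto simp: supp_def configs_def)
      then have "sum d (nonsink G s) < sum c (nonsink G s)"
        using finite_nonsink v
        by (intro sum_strict_mono_ex1) (auto simp: d_def grain_def supp_def intro!: bexI[of _ v])
      moreover have "d \<in> configs G s" "supp d \<subseteq> supp c"
        using less.prems(2) by (auto simp: d_def configs_def supp_def)
      ultimately have "good d" using less.IH less.prems(1) by blast
      then show ?thesis using good_add[of "grain v" d] v less.prems(1) c by simp
    qed
  qed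
qed

section \<open>Goodness along arcs\<close>

lemma good_grain_in_nonsink: "good (grain v) \<Longrightarrow> v \<in> nonsink G s"
  unfolding good_def configs_def grain_def by force

text \<open>A pile on \<open>v\<close> that topples exactly once has the same stabilizations,
  whatever is added, as the grains it sends out. Comparing the supports before and after the
  toppling gives the equivalence.\<close>

lemma good_grain_iff_heads:
  assumes v: "v \<in> nonsink G s"
  shows "good (grain v) \<longleftrightarrow> (\<forall>a \<in> out_arcs G v. head G a \<noteq> s \<longrightarrow> good (grain (head G a)))"
proof -
  define f where "f u = (if u = v then out_degree G v else 0)" for u
  have f: "f \<in> configs G s" "supp f = {v}"
    using v out_degree_pos[OF v] by (auto simp: f_def configs_def supp_def)
  have "stabilize G s (\<lambda>u. f u + y u) = stabilize G s (\<lambda>u. flow G s v u + y u)"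
    if "y \<in> configs G s" for y
    using stabilize_cong_steps[OF configs_add[OF f(1) that]] topple_stepI[OF v that]
    unfolding f_def by blast
  then have "good f \<longleftrightarrow> good (flow G s v)"
    unfolding good_def using f(1) flow_in_configs by auto
  moreover have "good f \<longleftrightarrow> good (grain v)" using good_iff_grains[OF f(1)] f(2) by simp
  moreover have "supp (flow G s v) = {head G a | a. a \<in> out_arcs G v \<and> head G a \<noteq> s}"
    by (auto simp: supp_def flow_def nonsink_def Suc_le_eq card_gt_0_iff)
  ultimately have "good (grain v) \<longleftrightarrow>
      (\<forall>u \<in> {head G a | a. a \<in> out_arcs G v \<and> head G a \<noteq> s}. good (grain u))"
    using good_iff_grains[OF flow_in_configs[of v]] by simp
  then show ?thesis by blast
qed

lemma good_grain_supp: "v \<in> supp e \<Longrightarrow> good (grain v)"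
proof -
  have "good e" unfolding good_def
    using e_config e_idem by blast
  then show "v \<in> supp e \<Longrightarrow> good (grain v)" using good_iff_grains[OF e_config] by blast
qed

text \<open>The forward direction of \<open>good_grain_iff_heads\<close>, iterated along a path
  avoiding the sink.\<close>

lemma good_grain_reachable:
  assumes "v \<rightarrow>\<^sup>*\<^bsub>sinkless\<^esub> u" "good (grain v)" shows "good (grain u)"
proof -
  interpret X: wf_digraph sinkless by (rule wf_digraph_del_vert)
  show ?thesis using assms
  proof (induction rule: X.reachable_induct)
    case base
    then show ?case by simp
  next
    case (step x y)
    then obtain a where "a \<in> out_arcs G x" "head G a = y" "y \<noteq> s"
      by (auto simp: del_vert_simps arcs_ends_conv)
    then show ?case
      using step good_grain_iff_heads[OF good_grain_in_nonsink, of x] by blast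
  qed
qed

section \<open>Cycles and the support of the idempotent\<close>

text \<open>Induction along the walk: a visited vertex is left by the next arc, except possibly the
  final one. On a closed walk the final vertex is also the initial one and is left by the first
  arc.\<close>

lemma awalk_successor:
  assumes "pre_digraph.awalk sinkless u p w" "z \<in> set (pre_digraph.awalk_verts sinkless u p)" "z \<noteq> w"
  shows "\<exists>a \<in> out_arcs G z. head G a \<in> set (pre_digraph.awalk_verts sinkless u p)"
proof -
  interpret X: wf_digraph sinkless by (rule wf_digraph_del_vert)
  show ?thesis using assms
  proof (induction p arbitrary: u)
    case Nil
    then show ?case by (auto simp: X.awalk_Nil_iff)
  next
    case (Cons a p)
    then have a: "a \<in> arcs sinkless" "tail sinkless a = u" "X.awalk (head sinkless a) p w"
      by (auto simp: X.awalk_Cons_iff)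
    have hd: "head sinkless a \<in> set (X.awalk_verts (head sinkless a) p)"
      using a(3) by (cases p) (auto simp: X.awalk_Cons_iff)
    have ht: "head sinkless a = head G a" "tail sinkless a = tail G a" "arcs sinkless \<subseteq> arcs G"
      by (auto simp: del_vert_simps)
    show ?case
    proof (cases "z = u")
      case True
      then show ?thesis using a hd ht by (intro bexI[of _ a]) auto
    next
      case False
      then have "z \<in> set (X.awalk_verts (head sinkless a) p)" using Cons.prems(2) a by auto
      then show ?thesis using Cons.IH[OF a(3)] Cons.prems(3) by auto
    qed
  qed
qed

text \<open>Adding \<open>y\<close> to the grain on \<open>z\<close> and stabilizing yields
  \<open>e\<close>; the cycle held a grain at the start, so it still holds one in
  \<open>e\<close>.\<close>

lemma cycle_meets_supp:
  assumes p: "pre_digraph.awalk sinkless u p u" "p \<noteq> []"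
    and z: "z \<in> set (pre_digraph.awalk_verts sinkless u p)" "good (grain z)"
  shows "set (pre_digraph.awalk_verts sinkless u p) \<inter> supp e \<noteq> {}"
proof -
  interpret X: wf_digraph sinkless by (rule wf_digraph_del_vert)
  let ?Z = "set (X.awalk_verts u p)"
  have succ: "\<exists>a \<in> out_arcs G x. head G a \<in> ?Z" if x: "x \<in> ?Z" for x
  proof (cases "x = u")
    case True
    obtain a q where pa: "p = a # q" using p(2) by (cases p) auto
    then have a: "a \<in> arcs sinkless" "tail sinkless a = u" using p(1) by (auto simp: X.awalk_Cons_iff)
    moreover have "head sinkless a \<in> ?Z"
      using p(1) unfolding pa by (cases q) (auto simp: X.awalk_Cons_iff)
    ultimately show ?thesis using True
      by (intro bexI[of _ a]) (auto simp: del_vert_simps)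
  next
    case False
    then show ?thesis using awalk_successor[OF p(1) x] by blast
  qed
  have "?Z \<subseteq> verts sinkless"
    using X.awalk_verts_in_verts[of u p] p(1) unfolding X.awalk_def by blast
  then have Z: "?Z \<subseteq> nonsink G s" by (simp add: nonsink_def verts_del_vert)
  obtain y where y: "grain z \<in> configs G s" "y \<in> configs G s"
      "stabilize G s (\<lambda>v. grain z v + y v) = e"
    using z(2) unfolding good_def by blast
  have "\<exists>x \<in> ?Z. grain z x + y x \<noteq> 0"
    using z(1) by (intro bexI[of _ z]) (auto simp: grain_def)
  from topple_steps_keep_grain[OF stabilize_steps(1)[OF configs_add[OF y(1,2)]]
      configs_add[OF y(1,2)] Z succ this]
  have "\<exists>x \<in> ?Z. e x \<noteq> 0" unfolding y(3) .
  then show ?thesis by (auto simp: supp_def)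
qed

section \<open>Good vertices as the non-sink vertices of \<open>S_graph\<close>\<close>

text \<open>A cycle through \<open>v\<close> would meet the support of \<open>e\<close> and put
  \<open>v\<close> into its closure. A cyclic component reachable from \<open>v\<close> contains a
  cycle of good vertices, which meets the support as well.\<close>

lemma good_grain_imp_S_graph:
  assumes "good (grain v)"
  shows "v \<in> cl sinkless (supp e) \<union> A_set sinkless e"
proof -
  interpret X: wf_digraph sinkless by (rule wf_digraph_del_vert)
  have v: "v \<in> verts sinkless"
    using good_grain_in_nonsink[OF assms] by (simp add: nonsink_def verts_del_vert)
  have "acyclic_vertex sinkless v" if ncl: "v \<notin> cl sinkless (supp e)"
    unfolding acyclic_vertex_def
  proof
    assume "\<exists>u p. X.awalk u p u \<and> p \<noteq> [] \<and> v \<in> set (X.awalk_verts u p)"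
    then obtain u p where p: "X.awalk u p u" "p \<noteq> []" "v \<in> set (X.awalk_verts u p)" by blast
    then obtain z where z: "z \<in> set (X.awalk_verts u p)" "z \<in> supp e"
      using cycle_meets_supp[OF p assms] by blast
    obtain q r where "X.awalk z q u" "X.awalk u r v"
      using X.awalk_decomp[OF p(1) z(1)] X.awalk_decomp[OF p(1) p(3)] by blast
    then have "z \<rightarrow>\<^sup>*\<^bsub>sinkless\<^esub> v"
      by (meson X.reachable_awalkI X.reachable_trans)
    then show False using ncl z(2) v by (auto simp: cl_def)
  qed
  moreover have "C \<inter> supp e \<noteq> {}"
    if C: "cyclic_scc sinkless C" "c \<in> C" "v \<rightarrow>\<^sup>*\<^bsub>sinkless\<^esub> c" for C c
  proof -
    obtain u p where p: "C \<in> X.sccs_verts" "X.awalk u p u" "p \<noteq> []" "set (X.awalk_verts u p) \<subseteq> C"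
      using C(1) unfolding cyclic_scc_def by blast
    have uZ: "u \<in> set (X.awalk_verts u p)" by (cases p) (use p(2) in \<open>auto simp: X.awalk_Cons_iff\<close>)
    then have "c \<rightarrow>\<^sup>*\<^bsub>sinkless\<^esub> u"
      using p(1,4) C(2) by (auto simp: X.in_sccs_verts_conv_reachable)
    then have "good (grain u)"
      using good_grain_reachable assms C(3) by blast
    then show ?thesis using cycle_meets_supp[OF p(2,3) uZ] p(4) by blast
  qed
  ultimately show ?thesis using v unfolding A_set_def by blast
qed

text \<open>On the closure, goodness spreads forward from the support. On \<open>A_set\<close> it is
  pulled back from out-neighbours, which stay in the vertex set by \<open>S_graph_closed\<close>; an
  out-neighbour lying on a cycle falls into the closure.\<close>

lemma S_graph_imp_good_grain:
  assumes "out_arcs G s = {}" "v \<in> cl sinkless (supp e) \<union> A_set sinkless e"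
  shows "good (grain v)"
proof -
  interpret X: fin_digraph sinkless by (rule fin_digraph_del_vert)
  have cl: "good (grain v)" if "v \<in> cl sinkless (supp e)" for v
    using that good_grain_reachable good_grain_supp unfolding cl_def by blast
  define r where "r = {(y, x). x \<rightarrow>\<^bsub>sinkless\<^esub> y \<and> acyclic_vertex sinkless x}"
  have "r \<subseteq> verts sinkless \<times> verts sinkless" by (auto simp: r_def)
  then have "finite r" by (rule finite_subset) simp
  moreover have "acyclic r"
  proof (rule acyclicI, rule allI, rule notI)
    fix x assume x: "(x, x) \<in> r\<^sup>+"
    have "r \<subseteq> (arcs_ends sinkless)\<inverse>" by (auto simp: r_def)
    then have "(x, x) \<in> ((arcs_ends sinkless)\<inverse>)\<^sup>+" using x trancl_mono by blast
    then have "x \<rightarrow>\<^sup>+\<^bsub>sinkless\<^esub> x" by (simp add: trancl_converse)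
    then obtain p where p: "X.awalk x p x" "p \<noteq> []" by (auto simp: X.reachable1_awalk)
    moreover have "x \<in> set (X.awalk_verts x p)" using p by (cases p) (auto simp: X.awalk_Cons_iff)
    moreover have "acyclic_vertex sinkless x"
      using x by (auto simp: r_def elim: tranclE)
    ultimately show False unfolding acyclic_vertex_def by blast
  qed
  ultimately have "wf r" by (rule finite_acyclic_wf)
  then show ?thesis using assms(2)
  proof (induction v rule: wf_induct_rule)
    case (less v)
    show ?case
    proof (cases "v \<in> cl sinkless (supp e)")
      case True
      then show ?thesis by (rule cl)
    next
      case False
      then have v: "v \<in> verts sinkless" "acyclic_vertex sinkless v"
        using less.prems by (auto simp: A_set_def)
      have "good (grain (head G a))" if a: "a \<in> out_arcs G v" "head G a \<noteq> s" for a
      proof (rule less.IH)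
        have "a \<in> arcs sinkless" using a v(1) by (auto simp: del_vert_simps)
        then show "(head G a, v) \<in> r"
          using a v X.in_arcs_imp_in_arcs_ends[of a] by (auto simp: r_def del_vert_simps)
        show "head G a \<in> cl sinkless (supp e) \<union> A_set sinkless e"
          using S_graph_closed[OF sandpile_graph_axioms assms(1), of a e] a less.prems
          by (auto simp: S_graph_simps)
      qed
      then show ?thesis
        using good_grain_iff_heads[of v] v(1) by (simp add: nonsink_def verts_del_vert)
    qed
  qed
qed

lemma nonsink_S_graph: "nonsink (S_graph G s e) s = cl sinkless (supp e) \<union> A_set sinkless e"
  by (auto simp: nonsink_def S_graph_simps cl_def A_set_def del_vert_simps)

text \<open>Turns accessibility of \<open>e\<close> into a condition on supports, the link between
  the group at \<open>e\<close> and the subgraph.\<close>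

lemma good_iff_S_graph_configs:
  assumes "out_arcs G s = {}"
  shows "good c \<longleftrightarrow> c \<in> configs (S_graph G s e) s"
proof -
  have gr: "good (grain v) \<longleftrightarrow> v \<in> nonsink (S_graph G s e) s" for v
    unfolding nonsink_S_graph
    by (rule iffI) (rule good_grain_imp_S_graph, assumption, rule S_graph_imp_good_grain[OF assms])
  have "nonsink (S_graph G s e) s \<subseteq> nonsink G s"
    using good_grain_in_nonsink gr by blast
  then have "configs (S_graph G s e) s \<subseteq> configs G s"
    unfolding configs_def by blast
  moreover have "c \<in> configs (S_graph G s e) s \<longleftrightarrow> supp c \<subseteq> nonsink (S_graph G s e) s"
    unfolding configs_def supp_def by (auto simp: Suc_le_eq)
  moreover have "good c \<Longrightarrow> c \<in> configs G s" by (simp add: good_def)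
  ultimately show ?thesis
    using good_iff_grains[of c] gr by blast
qed

end

section \<open>Subgraphs closed under out-arcs\<close>

lemma (in sandpile_graph) stabilize_closed_subgraph:
  assumes H: "sandpile_graph H s" "verts H \<subseteq> verts G" "head H = head G"
    and out: "\<And>v. v \<in> nonsink H s \<Longrightarrow> out_arcs H v = out_arcs G v"
    and hd: "\<And>a. a \<in> arcs G \<Longrightarrow> tail G a \<in> nonsink H s \<Longrightarrow> head G a \<in> verts H"
  shows "stable_configs H s = stable_configs G s \<inter> configs H s"
    and "c \<in> configs H s \<Longrightarrow> stabilize H s c = stabilize G s c"
proof -
  interpret H: sandpile_graph H s by fact
  have V: "nonsink H s \<subseteq> nonsink G s" using H(2) by (auto simp: nonsink_def)
  then have C: "configs H s \<subseteq> configs G s" by (auto simp: configs_def)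
  have deg: "out_degree H v = out_degree G v" if "v \<in> nonsink H s" for v
    using out[OF that] by (simp add: out_degree_def)
  show st: "stable_configs H s = stable_configs G s \<inter> configs H s"
  proof (intro subset_antisym subsetI)
    fix c assume c: "c \<in> stable_configs H s"
    have "c v < out_degree G v" if v: "v \<in> nonsink G s" for v
    proof (cases "v \<in> nonsink H s")
      case True
      then show ?thesis using c deg by (auto simp: stable_configs_def)
    next
      case False
      \<comment> \<open>Vertices outside \<open>H\<close> are empty, which is stable since their
        out-degree is positive.\<close>
      then show ?thesis using c out_degree_pos[OF v] by (auto simp: stable_configs_def configs_def)
    qed
    then show "c \<in> stable_configs G s \<inter> configs H s"
      using c C by (auto simp: stable_configs_def)
  next
    fix c assume "c \<in> stable_configs G s \<inter> configs H s"
    then show "c \<in> stable_configs H s" using V deg by (auto simp: stable_configs_def)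
  qed
  have flow: "flow H s v = flow G s v" if v: "v \<in> nonsink H s" for v
  proof
    fix u
    \<comment> \<open>No arc leaves \<open>H\<close> for a non-sink vertex of \<open>G\<close>
      outside it, so cutting off at either set of non-sink vertices gives the same flow.\<close>
    have "{a \<in> out_arcs G v. head G a = u} = {}" if "u \<in> nonsink G s" "u \<notin> nonsink H s"
      using hd v that by (auto simp: nonsink_def)
    then show "flow H s v u = flow G s v u"
      using V out[OF v] H(3) by (auto simp: flow_def)
  qed
  have step_G: "topple_step G s c d" if cd: "topple_step H s c d" "c \<in> configs H s" for c d
  proof -
    obtain v y where v: "v \<in> nonsink H s" "y \<in> configs H s"
      "c = (\<lambda>u. (if u = v then out_degree H v else 0) + y u)" "d = (\<lambda>u. flow H s v u + y u)"
      by (rule H.topple_stepE[OF cd])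
    have "v \<in> nonsink G s" "y \<in> configs G s" using v V C by auto
    from topple_stepI[OF this] show ?thesis unfolding v(3,4) deg[OF v(1)] flow[OF v(1)] .
  qed
  assume c: "c \<in> configs H s"
  have "(topple_step G s)\<^sup>*\<^sup>* c d" if "(topple_step H s)\<^sup>*\<^sup>* c d" for d
    using that
  proof (induction rule: rtranclp_induct)
    case base
    then show ?case by simp
  next
    case (step d d')
    then show ?case
      using step_G H.topple_steps_configs c by (meson rtranclp.rtrancl_into_rtrancl)
  qed
  then have "stabilize G s c = stabilize H s c"
    using H.stabilize_steps[OF c] c C st by (intro stabilize_eqI) auto
  then show "stabilize H s c = stabilize G s c" by simp
qed

section \<open>Maximal subgroups and minimal ideals of commutative monoids\<close>

text \<open>The right-hand side is the unit group of the monoid of multiples of \<open>e\<close>. It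
  contains every subgroup with identity \<open>e\<close>, so it is the greatest one and the only
  maximal one.\<close>

lemma maximal_subgroup_at_comm_monoid:
  fixes M (structure)
  assumes "comm_monoid M" "e \<in> carrier M" "e \<otimes> e = e"
  shows "maximal_subgroup_at M e = {m \<in> carrier M. m \<otimes> e = m \<and> (\<exists>n \<in> carrier M. m \<otimes> n = e)}"
    (is "_ = ?H")
proof -
  interpret comm_monoid M by fact
  have "group \<lparr>carrier = ?H, monoid.mult = (\<otimes>), one = e\<rparr>"
  proof (rule groupI)
    fix x assume "x \<in> carrier \<lparr>carrier = ?H, monoid.mult = (\<otimes>), one = e\<rparr>"
    then obtain n where x: "x \<in> carrier M" "x \<otimes> e = x" "n \<in> carrier M" "x \<otimes> n = e" by auto
    \<comment> \<open>\<open>n\<close> itself need not be fixed by \<open>e\<close>, so the inverse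
      is taken to be \<open>n \<otimes> e\<close>.\<close>
    have "(n \<otimes> e) \<otimes> (x \<otimes> e) = e"
      using x assms(2,3) m_ac by metis
    moreover have "(n \<otimes> e) \<otimes> e = n \<otimes> e"
      using x assms(2,3) m_assoc by metis
    ultimately have "n \<otimes> e \<in> ?H" "(n \<otimes> e) \<otimes> x = e" using x assms(2) by auto
    then show "\<exists>y \<in> carrier \<lparr>carrier = ?H, monoid.mult = (\<otimes>), one = e\<rparr>.
        y \<otimes>\<^bsub>\<lparr>carrier = ?H, monoid.mult = (\<otimes>), one = e\<rparr>\<^esub> x
        = \<one>\<^bsub>\<lparr>carrier = ?H, monoid.mult = (\<otimes>), one = e\<rparr>\<^esub>" by auto
  next
    fix x y assume "x \<in> carrier \<lparr>carrier = ?H, monoid.mult = (\<otimes>), one = e\<rparr>"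
      "y \<in> carrier \<lparr>carrier = ?H, monoid.mult = (\<otimes>), one = e\<rparr>"
    then obtain n k where x: "x \<in> carrier M" "x \<otimes> e = x" "n \<in> carrier M" "x \<otimes> n = e"
      and y: "y \<in> carrier M" "y \<otimes> e = y" "k \<in> carrier M" "y \<otimes> k = e" by auto
    have "(x \<otimes> y) \<otimes> (n \<otimes> k) = (x \<otimes> n) \<otimes> (y \<otimes> k)" using x(1,3) y(1,3) by (simp add: m_ac)
    then have "(x \<otimes> y) \<otimes> (n \<otimes> k) = e" using x y assms(3) by simp
    moreover have "(x \<otimes> y) \<otimes> e = x \<otimes> y" using x y assms(2) by (simp add: m_assoc)
    ultimately show "x \<otimes>\<^bsub>\<lparr>carrier = ?H, monoid.mult = (\<otimes>), one = e\<rparr>\<^esub> y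
        \<in> carrier \<lparr>carrier = ?H, monoid.mult = (\<otimes>), one = e\<rparr>"
      using x y by auto
  next
    fix x assume "x \<in> carrier \<lparr>carrier = ?H, monoid.mult = (\<otimes>), one = e\<rparr>"
    then have "x \<in> carrier M" "x \<otimes> e = x" by auto
    then have "e \<otimes> x = x" using m_comm[OF assms(2)] by simp
    then show "\<one>\<^bsub>\<lparr>carrier = ?H, monoid.mult = (\<otimes>), one = e\<rparr>\<^esub>
        \<otimes>\<^bsub>\<lparr>carrier = ?H, monoid.mult = (\<otimes>), one = e\<rparr>\<^esub> x = x" by simp
  qed (use assms(2,3) in \<open>auto simp: m_assoc\<close>)
  then have H: "subgroup_at M e ?H" by (auto simp: subgroup_at_def)
  have sub: "K \<subseteq> ?H" if K: "subgroup_at M e K" for K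
  proof
    fix m assume m: "m \<in> K"
    interpret K: group "\<lparr>carrier = K, monoid.mult = (\<otimes>), one = e\<rparr>"
      using K by (simp add: subgroup_at_def)
    have "m \<otimes> e = m" using K.r_one m by simp
    moreover obtain n where "n \<in> K" "m \<otimes> n = e" using K.r_inv_ex m by auto
    ultimately show "m \<in> ?H" using K m by (auto simp: subgroup_at_def)
  qed
  show ?thesis unfolding maximal_subgroup_at_def
    by (rule the_equality) (use H sub in blast)+
qed

text \<open>Since \<open>e\<close> is accessible from every element, each ideal contains
  \<open>e\<close> and hence all its multiples; these form an ideal, which is therefore the least
  one.\<close>

lemma minimal_ideal_comm_monoid:
  fixes M (structure)
  assumes "comm_monoid M" "e \<in> carrier M"
    and acc: "\<And>x. x \<in> carrier M \<Longrightarrow> \<exists>y \<in> carrier M. x \<otimes> y = e"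
  shows "minimal_ideal M = (\<lambda>x. e \<otimes> x) ` carrier M" (is "_ = ?I")
proof -
  interpret comm_monoid M by fact
  have absorb: "x \<otimes> (e \<otimes> z) \<in> ?I \<and> (e \<otimes> z) \<otimes> x \<in> ?I" if "x \<in> carrier M" "z \<in> carrier M" for x z
    using that assms(2) by (auto simp: m_ac intro!: image_eqI[of _ _ "x \<otimes> z"])
  then have I: "monoid_ideal M ?I"
    using assms(2) by (auto simp: monoid_ideal_def)
  have least: "?I \<subseteq> J" if J: "monoid_ideal M J" for J
  proof -
    obtain x where x: "x \<in> J" "x \<in> carrier M" using J by (auto simp: monoid_ideal_def)
    then obtain y where "y \<in> carrier M" "x \<otimes> y = e" using acc by blast
    then have "e \<in> J" using J x(1) unfolding monoid_ideal_def by blast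
    then show ?thesis using J unfolding monoid_ideal_def by blast
  qed
  show ?thesis unfolding minimal_ideal_def
    by (rule the_equality) (use I least in blast)+
qed

section \<open>Comparison of the two monoids and their groups\<close>

theorem theorem3p7:
  fixes G :: "('a, 'b) pre_digraph" and s :: 'a and e :: "'a \<Rightarrow> nat"
  assumes "sandpile_graph G s"
    and "out_arcs G s = {}"
    and "e \<in> carrier (sandpile_monoid G s)"
    and "e \<otimes>\<^bsub>sandpile_monoid G s\<^esub> e = e"
    and "e \<noteq> \<one>\<^bsub>sandpile_monoid G s\<^esub>"
  shows "maximal_subgroup_at (sandpile_monoid G s) e = sandpile_group (S_graph G s e) s \<and>
    (\<forall>a \<in> sandpile_group (S_graph G s e) s. \<forall>b \<in> sandpile_group (S_graph G s e) s.
       a \<otimes>\<^bsub>sandpile_monoid (S_graph G s e) s\<^esub> b = a \<otimes>\<^bsub>sandpile_monoid G s\<^esub> b)"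
proof -
  let ?S = "S_graph G s e"
  let ?M = "sandpile_monoid G s"
  let ?N = "sandpile_monoid ?S s"
  interpret sandpile_graph G s by fact
  interpret sandpile_idempotent G s e
    using assms(3,4) by unfold_locales (auto simp: sandpile_monoid_def)
  interpret S: sandpile_graph ?S s by (rule sandpile_graph_S_graph[OF assms(1,2,3,5)])
  interpret M: comm_monoid ?M by (rule comm_monoid_sandpile_monoid)
  interpret N: comm_monoid ?N by (rule S.comm_monoid_sandpile_monoid)
  have sub: "verts ?S \<subseteq> verts G"
    using sink_in_verts by (auto simp: S_graph_simps cl_def A_set_def del_vert_simps)
  have out: "out_arcs ?S v = out_arcs G v" if "v \<in> nonsink ?S s" for v
    using that arcs_S_graph[OF assms(1,2), of e] by (auto simp: S_graph_simps(2) nonsink_def)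
  have hd: "head G a \<in> verts ?S" if "a \<in> arcs G" "tail G a \<in> nonsink ?S s" for a
    using that S_graph_closed[OF assms(1,2), of a e] by (auto simp: nonsink_def)
  note closed = stabilize_closed_subgraph[OF S.sandpile_graph_axioms sub S_graph_simps(3) out hd]
  \<comment> \<open>The monoid of \<open>?S\<close> consists of exactly those stable configurations
    from which \<open>e\<close> is accessible.\<close>
  have carrier: "carrier ?N = {c \<in> carrier ?M. good c}"
    using closed(1) good_iff_S_graph_configs[OF assms(2)] by (auto simp: sandpile_monoid_def)
  have mult: "a \<otimes>\<^bsub>?N\<^esub> b = a \<otimes>\<^bsub>?M\<^esub> b" if "a \<in> carrier ?N" "b \<in> carrier ?N" for a b
    using that closed(2) S.configs_add S.stable_in_configs by (simp add: sandpile_monoid_def)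
  have good: "good a" if "a \<in> carrier ?M" "b \<in> carrier ?M" "a \<otimes>\<^bsub>?M\<^esub> b = e" for a b
    using that stable_in_configs unfolding good_def by (auto simp: sandpile_monoid_def)
  have eN: "e \<in> carrier ?N" using carrier good assms(3,4) by blast
  have acc: "\<exists>y \<in> carrier ?N. x \<otimes>\<^bsub>?N\<^esub> y = e" if x: "x \<in> carrier ?N" for x
  proof -
    have "good x" "x \<in> carrier ?M" using x carrier by auto
    then obtain y where y: "x \<in> configs G s" "y \<in> configs G s" "stabilize G s (\<lambda>v. x v + y v) = e"
      unfolding good_def by blast
    \<comment> \<open>The witness of goodness is made stable. It lies in \<open>?N\<close> because
      \<open>x\<close> in turn witnesses that it is good.\<close>
    let ?y = "stabilize G s y"
    have yM: "?y \<in> carrier ?M" using stabilize_steps(2)[OF y(2)] by (simp add: sandpile_monoid_def)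
    have "x \<otimes>\<^bsub>?M\<^esub> ?y = e"
      using stabilize_stabilize_add[OF y(2,1)] y(3) by (simp add: sandpile_monoid_def add.commute)
    moreover from this have "?y \<in> carrier ?N"
      using good[OF yM \<open>x \<in> carrier ?M\<close>] M.m_comm[OF yM \<open>x \<in> carrier ?M\<close>] carrier yM by simp
    ultimately show ?thesis using mult[OF x] by auto
  qed
  have K: "sandpile_group ?S s = (\<lambda>x. e \<otimes>\<^bsub>?N\<^esub> x) ` carrier ?N"
    unfolding sandpile_group_def
    by (rule minimal_ideal_comm_monoid[OF N.comm_monoid_axioms eN acc])
  have "maximal_subgroup_at ?M e = sandpile_group ?S s"
    unfolding maximal_subgroup_at_comm_monoid[OF M.comm_monoid_axioms assms(3,4)] K
  proof (intro subset_antisym subsetI)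
    fix m assume "m \<in> {m \<in> carrier ?M. m \<otimes>\<^bsub>?M\<^esub> e = m \<and> (\<exists>n \<in> carrier ?M. m \<otimes>\<^bsub>?M\<^esub> n = e)}"
    then have m: "m \<in> carrier ?M" "m \<otimes>\<^bsub>?M\<^esub> e = m" "m \<in> carrier ?N"
      \<comment> \<open>An inverse relative to \<open>e\<close> is a witness of goodness, so group
        elements live on the subgraph.\<close>
      using good carrier by auto
    then have "m = e \<otimes>\<^bsub>?N\<^esub> m" using mult eN M.m_comm assms(3) by metis
    then show "m \<in> (\<lambda>x. e \<otimes>\<^bsub>?N\<^esub> x) ` carrier ?N" using m(3) by blast
  next
    fix m assume "m \<in> (\<lambda>x. e \<otimes>\<^bsub>?N\<^esub> x) ` carrier ?N"
    then obtain x where x: "x \<in> carrier ?N" "m = e \<otimes>\<^bsub>?N\<^esub> x" by blast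
    obtain y where y: "y \<in> carrier ?N" "x \<otimes>\<^bsub>?N\<^esub> y = e" using acc[OF x(1)] by blast
    have xy: "x \<in> carrier ?M" "y \<in> carrier ?M" "m = e \<otimes>\<^bsub>?M\<^esub> x" "x \<otimes>\<^bsub>?M\<^esub> y = e"
      using x y carrier mult eN by auto
    have "m \<otimes>\<^bsub>?M\<^esub> e = m" using xy assms(3,4) M.m_assoc M.m_comm by metis
    \<comment> \<open>Here \<open>y\<close> inverts \<open>m = e \<otimes> x\<close>: the product is
      \<open>e \<otimes> (x \<otimes> y) = e \<otimes> e = e\<close>.\<close>
    moreover have "m \<otimes>\<^bsub>?M\<^esub> y = e" using xy assms(3,4) M.m_assoc by metis
    moreover have "m \<in> carrier ?M" using xy(1,3) assms(3) by simp
    ultimately show "m \<in> {m \<in> carrier ?M. m \<otimes>\<^bsub>?M\<^esub> e = m \<and> (\<exists>n \<in> carrier ?M. m \<otimes>\<^bsub>?M\<^esub> n = e)}"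
      using xy(2) by blast
  qed
  moreover have "sandpile_group ?S s \<subseteq> carrier ?N" using K eN by auto
  ultimately show ?thesis using mult by blast
qed

end
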